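(* There is a $2$-connected subcubic outerplanar graph that is not packing $(1,2,2)$-colorable. Namely, let $G$ be the graph with vertex set $\{u_1,u_2,u_3,u_4,v_1,v_2\}$ obtained from the $4$-cycle $u_1u_2u_3u_4u_1$ by adding a path $u_1v_1u_2$ of length two from $u_1$ to $u_2$ and a path $u_3v_2u_4$ of length two from $u_3$ to $u_4$. Then $G$ is not packing $(1,2,2)$-colorable.
   Context: A graph is subcubic if its maximum degree is at most $3$. For a non-decreasing sequence $S=(s_1,\dots,s_k)$ of positive integers, a packing $S$-coloring of a graph $G$ is a partition of $V(G)$ into sets $V_1,\dots,V_k$ (some possibly empty) such that, for each $1\le i\le k$, the distance in $G$ between any two distinct vertices $x,y\in V_i$ is at least $s_i+1$. $G$ is packing $S$-colorable if it has a packing $S$-coloring. *)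

theory Defs
  imports "HOL-Analysis.Analysis" "Graph_Theory.Graph_Theory"
begin

text \<open>
  Finite simple graphs are represented as in the Graph_Theory library: \<open>pair_graph G\<close> says that
  \<open>G\<close> is a finite, loop-free, symmetric set of vertex pairs. An edge \<open>xy\<close> is thus the two arcs
  \<open>(x, y)\<close> and \<open>(y, x)\<close>, and the degree of a vertex is its out-degree.
  The definitions below are meant for such \<open>G\<close>.
\<close>

definition subcubic :: "'a pair_pre_digraph \<Rightarrow> bool" where
  "subcubic G \<longleftrightarrow> (\<forall>v \<in> pverts G. out_degree (with_proj G) v \<le> 3)"

definition k_connected :: "nat \<Rightarrow> 'a pair_pre_digraph \<Rightarrow> bool" where
  "k_connected k G \<longleftrightarrow>
     card (pverts G) > k \<and>
     (\<forall>X \<subseteq> pverts G. card X < k \<longrightarrow>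
        Digraph_Component.connected (with_proj G \<restriction> (pverts G - X)))"

text \<open>
  A drawing places the vertices at distinct points \<open>p v\<close> of the plane and draws the edge \<open>uv\<close> as a
  simple arc \<open>\<gamma> (u, v)\<close> from \<open>p u\<close> to \<open>p v\<close>. The two arcs representing one edge are drawn on the
  same curve. Distinct edges meet only at common end vertices, and an edge contains no vertices
  other than its ends.
\<close>

definition plane_drawing ::
  "'a pair_pre_digraph \<Rightarrow> ('a \<Rightarrow> complex) \<Rightarrow> ('a \<times> 'a \<Rightarrow> real \<Rightarrow> complex) \<Rightarrow> bool" where
  "plane_drawing G p \<gamma> \<longleftrightarrow>
     inj_on p (pverts G) \<and>
     (\<forall>(u, v) \<in> parcs G.
        Path_Connected.arc (\<gamma> (u, v)) \<and>
        pathstart (\<gamma> (u, v)) = p u \<and> pathfinish (\<gamma> (u, v)) = p v \<and>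
        path_image (\<gamma> (v, u)) = path_image (\<gamma> (u, v)) \<and>
        path_image (\<gamma> (u, v)) \<inter> p ` pverts G = {p u, p v}) \<and>
     (\<forall>(u, v) \<in> parcs G. \<forall>(x, y) \<in> parcs G. {u, v} \<noteq> {x, y} \<longrightarrow>
        path_image (\<gamma> (u, v)) \<inter> path_image (\<gamma> (x, y)) \<subseteq> p ` ({u, v} \<inter> {x, y}))"

definition drawing_points ::
  "'a pair_pre_digraph \<Rightarrow> ('a \<Rightarrow> complex) \<Rightarrow> ('a \<times> 'a \<Rightarrow> real \<Rightarrow> complex) \<Rightarrow> complex set" where
  "drawing_points G p \<gamma> = p ` pverts G \<union> (\<Union>e \<in> parcs G. path_image (\<gamma> e))"

text \<open>The outer face of a drawing is the unbounded component of its complement, which is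
  \<open>outside (drawing_points G p \<gamma>)\<close>.\<close>

definition outerplanar :: "'a pair_pre_digraph \<Rightarrow> bool" where
  "outerplanar G \<longleftrightarrow>
     (\<exists>p \<gamma>. plane_drawing G p \<gamma> \<and>
        (\<forall>v \<in> pverts G. p v \<in> frontier (outside (drawing_points G p \<gamma>))))"

text \<open>The number of edges of a shortest path, \<open>\<infinity>\<close> if there is none.\<close>

definition graph_dist :: "'a pair_pre_digraph \<Rightarrow> 'a \<Rightarrow> 'a \<Rightarrow> ereal" where
  "graph_dist G x y = wf_digraph.\<mu> (with_proj G) (\<lambda>_. 1) x y"

text \<open>The sequence \<open>S\<close> is meant to be a non-decreasing list of positive integers; the class
  with bound \<open>S ! i\<close> is \<open>V i\<close>, with indices counted from 0.\<close>

definition packing_coloring :: "'a pair_pre_digraph \<Rightarrow> nat list \<Rightarrow> (nat \<Rightarrow> 'a set) \<Rightarrow> bool" where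
  "packing_coloring G S V \<longleftrightarrow>
     (\<Union>i < length S. V i) = pverts G \<and>
     disjoint_family_on V {..<length S} \<and>
     (\<forall>i < length S. \<forall>x \<in> V i. \<forall>y \<in> V i. x \<noteq> y \<longrightarrow> graph_dist G x y \<ge> ereal (real (S ! i + 1)))"

definition packing_colorable :: "'a pair_pre_digraph \<Rightarrow> nat list \<Rightarrow> bool" where
  "packing_colorable G S \<longleftrightarrow> (\<exists>V. packing_coloring G S V)"

datatype vertex = U1 | U2 | U3 | U4 | V1 | V2

definition example_edges :: "(vertex \<times> vertex) set" where
  "example_edges =
     {(U1, U2), (U2, U3), (U3, U4), (U4, U1)} \<union>
     {(U1, V1), (V1, U2)} \<union>
     {(U3, V2), (V2, U4)}"

definition example_graph :: "vertex pair_pre_digraph" where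
  "example_graph =
     \<lparr> pverts = {U1, U2, U3, U4, V1, V2}, parcs = example_edges \<union> example_edges\<inverse> \<rparr>"

end

theory Submission
  imports Defs
begin

text \<open>
  Deleting at most one vertex from the Hamiltonian cycle \<open>U1 V1 U2 U3 V2 U4\<close> leaves a Hamiltonian
  path. Drawing that cycle as a convex hexagon inscribed in a circle, with the chords \<open>U1 U2\<close> and
  \<open>U3 U4\<close>, puts all vertices on the outer face. Finally, \<open>{V1, V2}\<close> is the only pair of vertices at
  distance at least 3, so the two classes of bound 2 have together at most three elements, while
  an independent set has at most one vertex in each of the triangles \<open>U1 V1 U2\<close> and \<open>U3 V2 U4\<close>.
\<close>

section \<open>Connectivity\<close>

text \<open>Induction on the list, prepending one arc at a time. Confining the walk to
  \<open>V\<close> matches the reachability used for an induced subgraph.\<close>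

lemma rtrancl_on_successively:
  assumes "successively (\<lambda>u v. (u, v) \<in> R) xs" "set xs \<subseteq> V" "v \<in> set xs"
  shows "(hd xs, v) \<in> rtrancl_on V R"
  using assms
proof (induction xs)
  case (Cons x xs)
  show ?case
  proof (cases "v = x")
    case False
    with Cons.prems have v: "v \<in> set xs" and "xs \<noteq> []" by auto
    with Cons have "(hd xs, v) \<in> rtrancl_on V R" "(x, hd xs) \<in> R"
      by (auto simp: successively_Cons)
    with Cons.prems show ?thesis
      by (auto intro: converse_rtrancl_on_into_rtrancl_on)
  qed (use Cons.prems in auto)
qed simp

text \<open>The head of the list reaches every vertex, so by symmetry any two vertices are joined
  through the head.\<close>

lemma connected_induced_if_hamiltonian_path:
  assumes "successively (\<lambda>u v. (u, v) \<in> parcs G) xs" "xs \<noteq> []"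
  shows "Digraph_Component.connected (with_proj G \<restriction> set xs)"
proof -
  \<comment> \<open>Connectedness of a digraph is reachability in the symmetric closure of its arcs,
    so arcs may be traversed backwards.\<close>
  define R where "R = (arcs_ends (with_proj G \<restriction> set xs))\<^sup>s"
  have "successively (\<lambda>u v. (u, v) \<in> R) xs"
    using assms(1) by (rule successively_mono)
      (auto simp: R_def arcs_ends_def arc_to_ends_def symcl_def)
  then have hd: "(hd xs, v) \<in> rtrancl_on (set xs) R" if "v \<in> set xs" for v
    using that by (intro rtrancl_on_successively) auto
  have "sym (rtrancl_on (set xs) R)"
    by (intro rtrancl_on_sym) (auto simp: R_def symcl_def sym_def)
  then have "(u, v) \<in> rtrancl_on (set xs) R" if "u \<in> set xs" "v \<in> set xs" for u v
    using hd[OF that(1)] hd[OF that(2)] by (blast intro: rtrancl_on_trans dest: symD)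
  then show ?thesis
    using assms(2) by (auto simp: connected_conv R_def)
qed

section \<open>Straight-line drawings\<close>

text \<open>Positive on one side of the line through \<open>a\<close> and \<open>b\<close>, negative on the other.\<close>

definition line_side :: "complex \<Rightarrow> complex \<Rightarrow> complex \<Rightarrow> real" where
  "line_side a b z = Im ((z - a) * cnj (b - a))"

lemma line_side_convex_combination:
  "line_side a b ((1 - t) *\<^sub>R x + t *\<^sub>R y) = (1 - t) * line_side a b x + t * line_side a b y"
  by (simp add: line_side_def algebra_simps)

lemma line_side_closed_segment:
  assumes "z \<in> closed_segment a b"
  shows "line_side a b z = 0"
proof -
  have "line_side a b a = 0" "line_side a b b = 0"
    by (simp_all add: line_side_def algebra_simps)
  with assms show ?thesis
    by (auto simp: in_segment line_side_convex_combination)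
qed

text \<open>On the segment from \<open>x\<close> to \<open>y\<close>, \<open>line_side a b\<close>
  is a weighted mean of two values that do not have opposite signs. It vanishes at \<open>z\<close>
  only if both weighted terms do; as the end values are not both 0, one weight is 0 and
  \<open>z\<close> is an end lying on the line.\<close>

lemma closed_segment_Int_same_side:
  assumes "line_side a b x * line_side a b y \<ge> 0"
    and "\<not> (line_side a b x = 0 \<and> line_side a b y = 0)"
    and "z \<in> closed_segment a b" "z \<in> closed_segment x y"
  shows "z = x \<and> line_side a b x = 0 \<or> z = y \<and> line_side a b y = 0"
proof -
  obtain t where t: "0 \<le> t" "t \<le> 1" "z = (1 - t) *\<^sub>R x + t *\<^sub>R y"
    using assms(4) by (auto simp: in_segment)
  have eq: "(1 - t) * line_side a b x + t * line_side a b y = 0"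
    using line_side_closed_segment[OF assms(3)] t(3) by (simp add: line_side_convex_combination)
  have "(1 - t) * line_side a b x = 0 \<and> t * line_side a b y = 0"
  proof (cases "line_side a b x \<ge> 0 \<and> line_side a b y \<ge> 0")
    case True
    then show ?thesis
      using eq t mult_nonneg_nonneg[of "1 - t" "line_side a b x"]
        mult_nonneg_nonneg[of t "line_side a b y"] by linarith
  next
    case False
    then have "line_side a b x \<le> 0" "line_side a b y \<le> 0"
      using assms(1) by (auto simp: zero_le_mult_iff)
    then show ?thesis
      using eq t mult_nonneg_nonpos[of "1 - t" "line_side a b x"]
        mult_nonneg_nonpos[of t "line_side a b y"] by linarith
  qed
  then show ?thesis
    using assms(2) t(3) by auto
qed

text \<open>Reduces planarity to finitely many sign conditions: no third vertex lies on the line of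
  an edge, and no edge has its ends strictly on opposite sides of such a line.\<close>

lemma plane_drawing_straight_line:
  fixes p :: "'a \<Rightarrow> complex"
  assumes "pair_graph G" and inj: "inj_on p (pverts G)"
    and off_line: "\<And>u v w. (u, v) \<in> parcs G \<Longrightarrow> w \<in> pverts G \<Longrightarrow>
      line_side (p u) (p v) (p w) = 0 \<Longrightarrow> w \<in> {u, v}"
    and same_side: "\<And>u v x y. (u, v) \<in> parcs G \<Longrightarrow> (x, y) \<in> parcs G \<Longrightarrow>
      line_side (p u) (p v) (p x) * line_side (p u) (p v) (p y) \<ge> 0"
  shows "plane_drawing G p (\<lambda>(u, v). linepath (p u) (p v))"
proof -
  interpret pair_graph G by fact
  have verts: "u \<in> pverts G" "v \<in> pverts G" "u \<noteq> v" "p u \<noteq> p v" if "(u, v) \<in> parcs G" for u v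
    using that in_arcsD1 in_arcsD2 no_loops' inj by (fastforce dest: inj_onD)+
  have ends: "closed_segment (p u) (p v) \<inter> p ` pverts G = {p u, p v}"
    if uv: "(u, v) \<in> parcs G" for u v
    using verts[OF uv] off_line[OF uv] by (auto dest: line_side_closed_segment)
  have cross: "z \<in> p ` ({u, v} \<inter> {x, y})"
    if uv: "(u, v) \<in> parcs G" and xy: "(x, y) \<in> parcs G" and neq: "{u, v} \<noteq> {x, y}"
      and z: "z \<in> closed_segment (p u) (p v)" "z \<in> closed_segment (p x) (p y)" for u v x y z
  proof -
    \<comment> \<open>If both ends of \<open>xy\<close> were on the line of \<open>uv\<close>, both
      would belong to \<open>{u, v}\<close> and the two edges would coincide.\<close>
    have on: "w \<in> {u, v}" if "w \<in> {x, y}" "line_side (p u) (p v) (p w) = 0" for w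
      using off_line[OF uv] that verts[OF xy] by blast
    then have "\<not> (line_side (p u) (p v) (p x) = 0 \<and> line_side (p u) (p v) (p y) = 0)"
      using neq verts(3)[OF xy] by blast
    from closed_segment_Int_same_side[OF same_side[OF uv xy] this z] show ?thesis
      using on by blast
  qed
  show ?thesis
    unfolding plane_drawing_def
  proof (intro conjI ballI)
    show "inj_on p (pverts G)" by fact
  next
    fix e assume "e \<in> parcs G"
    moreover obtain u v where "e = (u, v)" by (cases e)
    ultimately show "case e of (u, v) \<Rightarrow>
        Path_Connected.arc ((\<lambda>(u, v). linepath (p u) (p v)) (u, v)) \<and>
        pathstart ((\<lambda>(u, v). linepath (p u) (p v)) (u, v)) = p u \<and>
        pathfinish ((\<lambda>(u, v). linepath (p u) (p v)) (u, v)) = p v \<and>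
        path_image ((\<lambda>(u, v). linepath (p u) (p v)) (v, u)) =
          path_image ((\<lambda>(u, v). linepath (p u) (p v)) (u, v)) \<and>
        path_image ((\<lambda>(u, v). linepath (p u) (p v)) (u, v)) \<inter> p ` pverts G = {p u, p v}"
      using verts(4) ends by (simp add: closed_segment_commute arc_linepath)
  next
    fix e assume e: "e \<in> parcs G"
    obtain u v where uv: "e = (u, v)" by (cases e)
    have "{u, v} \<noteq> {x, y} \<longrightarrow>
        closed_segment (p u) (p v) \<inter> closed_segment (p x) (p y) \<subseteq> p ` ({u, v} \<inter> {x, y})"
      if "(x, y) \<in> parcs G" for x y
      using cross[of u v x y] e that unfolding uv by blast
    then show "case e of (u, v) \<Rightarrow> \<forall>(x, y) \<in> parcs G. {u, v} \<noteq> {x, y} \<longrightarrow>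
        path_image ((\<lambda>(u, v). linepath (p u) (p v)) (u, v)) \<inter>
          path_image ((\<lambda>(u, v). linepath (p u) (p v)) (x, y)) \<subseteq> p ` ({u, v} \<inter> {x, y})"
      unfolding uv prod.case path_image_linepath by (intro ballI) (simp only: split_paired_all prod.case)
  qed
qed

text \<open>The complement of the disc is contained in the outer face and has \<open>z\<close> as a
  limit point, while \<open>z\<close> itself belongs to \<open>S\<close>.\<close>

lemma frontier_outside_if_on_circle:
  fixes z :: complex
  assumes "z \<in> S" "S \<subseteq> cball 0 r" "norm z = r"
  shows "z \<in> frontier (outside S)"
proof -
  have "z \<in> frontier (cball 0 r)"
    using assms(3) by simp
  then have "z \<in> closure (- cball 0 r)"
    by (simp add: frontier_closures)
  moreover have "- cball 0 r \<subseteq> outside S"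
    using assms(2) by (intro outside_subset_convex) auto
  ultimately have "z \<in> closure (outside S)"
    using closure_mono by blast
  moreover have "z \<notin> interior (outside S)"
    using assms(1) interior_subset outside_no_overlap[of S] by blast
  ultimately show ?thesis
    by (simp add: frontier_def)
qed

lemma outerplanar_if_straight_line_on_circle:
  fixes p :: "'a \<Rightarrow> complex"
  assumes "pair_graph G" and drawing: "plane_drawing G p (\<lambda>(u, v). linepath (p u) (p v))"
    and circle: "\<And>v. v \<in> pverts G \<Longrightarrow> norm (p v) = r"
  shows "outerplanar G"
proof -
  interpret pair_graph G by fact
  have "closed_segment (p u) (p v) \<subseteq> cball 0 r" if "(u, v) \<in> parcs G" for u v
    using that circle[OF in_arcsD1] circle[OF in_arcsD2] by (intro closed_segment_subset) auto
  then have "drawing_points G p (\<lambda>(u, v). linepath (p u) (p v)) \<subseteq> cball 0 r"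
    using circle by (fastforce simp: drawing_points_def)
  then show ?thesis
    unfolding outerplanar_def using drawing circle
    by (intro exI conjI ballI frontier_outside_if_on_circle) (auto simp: drawing_points_def)
qed

section \<open>Distances\<close>

text \<open>The distance is at most the cost of any one walk. Such upper bounds suffice to show that
  two vertices are too close to share a class.\<close>

lemma graph_dist_le_1:
  assumes "pair_graph G" "(u, v) \<in> parcs G"
  shows "graph_dist G u v \<le> 1"
proof -
  interpret pair_graph G by fact
  have "awalk u [(u, v)] v"
    using assms(2) in_arcsD1 in_arcsD2 by (auto simp: awalk_def)
  from min_cost_le_walk_cost[OF this, of "\<lambda>_. 1"] show ?thesis
    by (simp add: graph_dist_def one_ereal_def)
qed

lemma graph_dist_le_2:
  assumes "pair_graph G" "(u, w) \<in> parcs G" "(w, v) \<in> parcs G"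
  shows "graph_dist G u v \<le> 2"
proof -
  interpret pair_graph G by fact
  have "awalk u [(u, w), (w, v)] v"
    using assms(2,3) in_arcsD1 in_arcsD2 by (auto simp: awalk_def)
  from min_cost_le_walk_cost[OF this, of "\<lambda>_. 1"] show ?thesis
    by (simp add: graph_dist_def)
qed

section \<open>The example graph\<close>

lemma pverts_example: "pverts example_graph = {U1, U2, U3, U4, V1, V2}"
  by (simp add: example_graph_def)

lemma parcs_example:
  "parcs example_graph =
     {(U1, U2), (U2, U3), (U3, U4), (U4, U1), (U1, V1), (V1, U2), (U3, V2), (V2, U4),
      (U2, U1), (U3, U2), (U4, U3), (U1, U4), (V1, U1), (U2, V1), (V2, U3), (U4, V2)}"
  by (auto simp: example_graph_def example_edges_def)

lemma pair_graph_example: "pair_graph example_graph"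
  by unfold_locales
    (auto simp: pverts_example parcs_example symmetric_def sym_def)

lemma k_connected_2_example: "k_connected 2 example_graph"
  unfolding k_connected_def
proof (intro conjI allI impI)
  show "2 < card (pverts example_graph)"
    by (simp add: pverts_example)
next
  fix X assume "X \<subseteq> pverts example_graph" "card X < 2"
  moreover have "finite (pverts example_graph)"
    by (simp add: pverts_example)
  ultimately have "X = {} \<or> (\<exists>x \<in> pverts example_graph. X = {x})"
    by (metis card_0_eq card_1_singletonE finite_subset insert_subset less_2_cases_iff One_nat_def)
  then obtain xs where "pverts example_graph - X = set xs" "xs \<noteq> []"
    "successively (\<lambda>u v. (u, v) \<in> parcs example_graph) xs"
  proof (elim disjE bexE)
    assume "X = {}"
    \<comment> \<open>Every list below follows the Hamiltonian cycle; when a vertex is deleted, it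
      starts at the successor of that vertex.\<close>
    then show ?thesis
      by (intro that[of "[U1, V1, U2, U3, V2, U4]"]) (auto simp: pverts_example parcs_example)
  next
    fix x assume X: "X = {x}"
    show ?thesis
    proof (cases x)
      case U1
      with X show ?thesis
        by (intro that[of "[V1, U2, U3, V2, U4]"]) (auto simp: pverts_example parcs_example)
    next
      case V1
      with X show ?thesis
        by (intro that[of "[U2, U3, V2, U4, U1]"]) (auto simp: pverts_example parcs_example)
    next
      case U2
      with X show ?thesis
        by (intro that[of "[U3, V2, U4, U1, V1]"]) (auto simp: pverts_example parcs_example)
    next
      case U3
      with X show ?thesis
        by (intro that[of "[V2, U4, U1, V1, U2]"]) (auto simp: pverts_example parcs_example)
    next
      case V2
      with X show ?thesis
        by (intro that[of "[U4, U1, V1, U2, U3]"]) (auto simp: pverts_example parcs_example)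
    next
      case U4
      with X show ?thesis
        by (intro that[of "[U1, V1, U2, U3, V2]"]) (auto simp: pverts_example parcs_example)
    qed
  qed
  then show "Digraph_Component.connected (with_proj example_graph \<restriction> (pverts example_graph - X))"
    by (simp add: connected_induced_if_hamiltonian_path)
qed

lemma subcubic_example: "subcubic example_graph"
proof -
  \<comment> \<open>As an intersection with an explicit finite set, the out-arcs can be enumerated
    by simplification.\<close>
  have "out_arcs (with_proj example_graph) v = parcs example_graph \<inter> {v} \<times> UNIV" for v
    by (auto simp: out_arcs_def)
  then show ?thesis
    by (simp add: subcubic_def out_degree_def pverts_example parcs_example Int_insert_left)
qed

text \<open>Integer points on the circle of radius 5, listed clockwise along the Hamiltonian cycle,
  so all side conditions are integer arithmetic. The chords \<open>U1 U2\<close> and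
  \<open>U3 U4\<close> are vertical.\<close>

fun hexagon :: "vertex \<Rightarrow> complex" where
  "hexagon U1 = Complex 3 4"
| "hexagon V1 = Complex 5 0"
| "hexagon U2 = Complex 3 (-4)"
| "hexagon U3 = Complex (-3) (-4)"
| "hexagon V2 = Complex (-5) 0"
| "hexagon U4 = Complex (-3) 4"

lemma outerplanar_example: "outerplanar example_graph"
proof (rule outerplanar_if_straight_line_on_circle[OF pair_graph_example])
  show "norm (hexagon v) = 5" for v
    by (cases v) (auto simp: cmod_def intro: real_sqrt_unique)
  show "plane_drawing example_graph hexagon (\<lambda>(u, v). linepath (hexagon u) (hexagon v))"
  proof (rule plane_drawing_straight_line[OF pair_graph_example])
    show "inj_on hexagon (pverts example_graph)"
      by (auto simp: inj_on_def pverts_example)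
  next
    fix u v w
    assume "(u, v) \<in> parcs example_graph" "line_side (hexagon u) (hexagon v) (hexagon w) = 0"
    then show "w \<in> {u, v}"
      by (cases w) (auto simp: parcs_example line_side_def)
  next
    fix u v x y
    assume "(u, v) \<in> parcs example_graph" "(x, y) \<in> parcs example_graph"
    then show "line_side (hexagon u) (hexagon v) (hexagon x) *
        line_side (hexagon u) (hexagon v) (hexagon y) \<ge> 0"
      unfolding parcs_example by (elim insertE emptyE) (simp_all add: line_side_def)
  qed
qed

lemma graph_dist_example_le_2:
  assumes "{x, y} \<noteq> {V1, V2}" "x \<noteq> y"
  shows "graph_dist example_graph x y \<le> 2"
proof -
  \<comment> \<open>The middle vertex can be taken on the 4-cycle: \<open>V1\<close> and
    \<open>V2\<close> are common neighbours only of pairs that are already adjacent.\<close>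
  have "(x, y) \<in> parcs example_graph \<or>
      (\<exists>w \<in> {U1, U2, U3, U4}. (x, w) \<in> parcs example_graph \<and> (w, y) \<in> parcs example_graph)"
    using assms by (cases x; cases y) (simp_all add: parcs_example insert_commute)
  then show ?thesis
    using graph_dist_le_1[OF pair_graph_example] graph_dist_le_2[OF pair_graph_example]
    by (force intro: order_trans[of _ 1])
qed

text \<open>The class sizes add up to at most 2 + 3 = 5, but there are six vertices.\<close>

lemma not_packing_colorable_example: "\<not> packing_colorable example_graph [1, 2, 2]"
proof
  assume "packing_colorable example_graph [1, 2, 2]"
  then obtain V where "packing_coloring example_graph [1, 2, 2] V"
    by (auto simp: packing_colorable_def)
  \<comment> \<open>The classes \<open>V 0\<close>, \<open>V 1\<close>, \<open>V 2\<close> are not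
    to be confused with the vertices \<open>V1\<close>, \<open>V2\<close>. The bounds 1, 2, 2
    require distances of at least 2, 3, 3.\<close>
  then have cover: "V 0 \<union> V 1 \<union> V 2 = {U1, U2, U3, U4, V1, V2}"
    and far0: "\<And>x y. x \<in> V 0 \<Longrightarrow> y \<in> V 0 \<Longrightarrow> x \<noteq> y \<Longrightarrow> graph_dist example_graph x y \<ge> 2"
    and far1: "\<And>x y. x \<in> V 1 \<Longrightarrow> y \<in> V 1 \<Longrightarrow> x \<noteq> y \<Longrightarrow> graph_dist example_graph x y \<ge> 3"
    and far2: "\<And>x y. x \<in> V 2 \<Longrightarrow> y \<in> V 2 \<Longrightarrow> x \<noteq> y \<Longrightarrow> graph_dist example_graph x y \<ge> 3"
    and disj: "V 1 \<inter> V 2 = {}"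
    by (auto simp: packing_coloring_def pverts_example lessThan_Suc numeral_eq_Suc
        less_Suc_eq all_conj_distrib disjoint_family_on_def)
  have sub: "V i \<subseteq> {U1, U2, U3, U4, V1, V2}" if "i \<in> {0, 1, 2}" for i
    using that cover by blast
  have fin: "finite (V i)" if "i \<in> {0, 1, 2}" for i
    using sub[OF that] by (rule finite_subset) simp
  have indep: "(x, y) \<notin> parcs example_graph" if "x \<in> V 0" "y \<in> V 0" "x \<noteq> y" for x y
  proof
    assume "(x, y) \<in> parcs example_graph"
    with far0[OF that] graph_dist_le_1[OF pair_graph_example] have "(2 :: ereal) \<le> 1"
      by (blast intro: order_trans)
    then show False by simp
  qed
  have triangle: "card (V 0 \<inter> T) \<le> 1" if "T \<in> {{U1, V1, U2}, {U3, V2, U4}}" for T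
  proof -
    have "(x, y) \<in> parcs example_graph" if "x \<in> T" "y \<in> T" "x \<noteq> y" for x y
      using that \<open>T \<in> _\<close> by (auto simp: parcs_example)
    then have "\<forall>x \<in> V 0 \<inter> T. \<forall>y \<in> V 0 \<inter> T. x = y"
      using indep by blast
    then show ?thesis
      using fin[of 0] by (simp add: card_le_Suc0_iff_eq)
  qed
  \<comment> \<open>The two triangles together contain all six vertices.\<close>
  have "V 0 = (V 0 \<inter> {U1, V1, U2}) \<union> (V 0 \<inter> {U3, V2, U4})"
    using sub[of 0] by auto
  then have "card (V 0) \<le> card (V 0 \<inter> {U1, V1, U2}) + card (V 0 \<inter> {U3, V2, U4})"
    by (metis card_Un_le)
  then have card0: "card (V 0) \<le> 2"
    using triangle[of "{U1, V1, U2}"] triangle[of "{U3, V2, U4}"] by simp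
  have pair: "{x, y} = {V1, V2}" if "x \<in> V i" "y \<in> V i" "x \<noteq> y" "i \<in> {1, 2}" for x y i
  proof (rule ccontr)
    assume "{x, y} \<noteq> {V1, V2}"
    with that have "graph_dist example_graph x y \<le> 2"
      by (intro graph_dist_example_le_2)
    moreover have "graph_dist example_graph x y \<ge> 3"
      using that far1 far2 by auto
    ultimately have "(3 :: ereal) \<le> 2"
      by (rule order_trans[rotated])
    then show False by simp
  qed
  have small: "card (V i) \<le> 1 \<or> V i = {V1, V2}" if i: "i \<in> {1, 2}" for i
  proof (cases "\<forall>x \<in> V i. \<forall>y \<in> V i. x = y")
    case True
    then show ?thesis
      using fin[of i] i by (auto simp: card_le_Suc0_iff_eq)
  next
    case False
    then obtain x y where xy: "x \<in> V i" "y \<in> V i" "x \<noteq> y"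
      by blast
    \<comment> \<open>Either \<open>z\<close> is \<open>x\<close>, or the pair \<open>z\<close>,
      \<open>x\<close> is itself \<open>{V1, V2}\<close>; hence there is no third element.\<close>
    have "z \<in> {V1, V2}" if "z \<in> V i" for z
      using pair[OF that xy(1) _ i] pair[OF xy(1) xy(2) xy(3) i] by blast
    moreover have "{V1, V2} \<subseteq> V i"
      unfolding pair[OF xy i, symmetric] using xy by simp
    ultimately show ?thesis by blast
  qed
  have card12: "card (V 1) + card (V 2) \<le> 3"
  \<comment> \<open>Disjointness forbids both classes from being \<open>{V1, V2}\<close>; otherwise
    at least one of them has at most one element, and the sum is at most 2 + 1.\<close>
  proof (cases "V 1 = {V1, V2} \<and> V 2 = {V1, V2}")
    case False
    have two: "card {V1, V2} = 2" by simp
    from False show ?thesis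
      using small[of 1] small[of 2] two by fastforce
  qed (use disj in auto)
  have "6 = card (V 0 \<union> V 1 \<union> V 2)"
    unfolding cover by simp
  also have "\<dots> \<le> card (V 0 \<union> V 1) + card (V 2)"
    by (rule card_Un_le)
  also have "\<dots> \<le> card (V 0) + card (V 1) + card (V 2)"
    by (simp add: card_Un_le)
  also have "\<dots> \<le> 5"
    using card0 card12 by simp
  finally show False by simp
qed

theorem mainTheorem8:
  shows "pair_graph example_graph \<and>
    k_connected 2 example_graph \<and>
    subcubic example_graph \<and>
    outerplanar example_graph \<and>
    \<not> packing_colorable example_graph [1, 2, 2]"
  using pair_graph_example k_connected_2_example subcubic_example outerplanar_example
    not_packing_colorable_example by blast

end
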